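(* Let $\pi\colon G\to H$ be a universally measurable group homomorphism from a Polish group $G$ into a second countable, locally compact group $H$. Then $\pi$ is continuous.
   Context: A Polish space is a separable topological space whose topology can be induced by a complete metric; a topological group is Polish if its topology is Polish. Locally compact groups are Hausdorff by convention, so a second countable, locally compact group is Polish. A subset $A$ of a Polish space $X$ is universally measurable if for every Borel probability measure $\mu$ on $X$ the set $A$ is $\mu$-measurable, i.e., $A$ differs from a Borel set by a set of $\mu$-measure $0$. A function $f\colon X\to Y$ between Polish spaces is universally measurable if $f^{-1}(U)$ is universally measurable in $X$ for every open $U\subseteq Y$. *)

theory Defs
  imports "HOL-Algebra.Group" "HOL-Probability.Probability"
begin

definition polish_topology :: "'a topology \<Rightarrow> bool" where
  "polish_topology X \<longleftrightarrow> separable_space X \<and> completely_metrizable_space X"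

text \<open>No separation axiom is part of \<^term>\<open>topological_group\<close>; it is implied by complete
  metrizability in \<^term>\<open>polish_group\<close> and required explicitly in
  \<^term>\<open>locally_compact_group\<close>.\<close>

locale topological_group = group G
  for G :: "('a, 'm) monoid_scheme" (structure) and T :: "'a topology" +
  assumes topspace_eq_carrier: "topspace T = carrier G"
    and continuous_mult: "continuous_map (prod_topology T T) T (\<lambda>(x, y). x \<otimes> y)"
    and continuous_inv: "continuous_map T T (\<lambda>x. inv x)"

locale polish_group = topological_group +
  assumes polish: "polish_topology T"

locale locally_compact_group = topological_group +
  assumes Hausdorff: "Hausdorff_space T"
    and locally_compact: "locally_compact_space T"

text \<open>The library's \<^term>\<open>borel\<close> is tied to type classes; this is the set of Borel sets of an
  abstract topology.\<close>

definition borel_sets_of :: "'a topology \<Rightarrow> 'a set set" where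
  "borel_sets_of X = sigma_sets (topspace X) {U. openin X U}"

text \<open>The symmetric difference below need not itself be Borel, so it is required to lie in a
  \<open>\<mu>\<close>-null Borel set. The equation for \<^term>\<open>sets \<mu>\<close> also forces
  \<^term>\<open>space \<mu> = topspace X\<close>.\<close>

definition universally_measurable_set :: "'a topology \<Rightarrow> 'a set \<Rightarrow> bool" where
  "universally_measurable_set X A \<longleftrightarrow>
     A \<subseteq> topspace X \<and>
     (\<forall>\<mu>. prob_space \<mu> \<and> sets \<mu> = borel_sets_of X \<longrightarrow>
        (\<exists>B\<in>borel_sets_of X. \<exists>N\<in>null_sets \<mu>. (A - B) \<union> (B - A) \<subseteq> N))"

definition universally_measurable_map ::
    "'a topology \<Rightarrow> 'b topology \<Rightarrow> ('a \<Rightarrow> 'b) \<Rightarrow> bool" where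
  "universally_measurable_map X Y f \<longleftrightarrow>
     f \<in> topspace X \<rightarrow> topspace Y \<and>
     (\<forall>U. openin Y U \<longrightarrow> universally_measurable_set X {x \<in> topspace X. f x \<in> U})"

end

theory Submission
  imports Defs
begin

text \<open>The proof rests on Christensen's method of random products. Let \<open>\<E>\<close> be a countable cover of a
  Polish group by universally measurable sets. Choosing \<open>g n\<close> close enough to the identity, the
  infinite product of the terms \<open>g n\<close> selected by a random binary sequence \<open>\<alpha>\<close> converges and depends
  measurably on \<open>\<alpha>\<close>. Some member \<open>E\<close> of the cover contains the product with positive probability,
  and as in Steinhaus' theorem there are two sequences that differ in exactly one
  coordinate \<open>n\<close> whose products both lie in \<open>E\<close>. The tails of the two products cancel in
  the quotient, which is therefore a conjugate of \<open>g n\<close> by an element that is determined by the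
  earlier terms. As there are only finitely many such elements, this yields: for every
  neighbourhood \<open>Q\<close> of the identity there is a finite set \<open>F \<subseteq> Q\<close> such that every element close to
  the identity has a conjugate by an element of \<open>F\<close> of the form \<open>x y\<inverse>\<close> with \<open>x\<close> and \<open>y\<close> in a common
  member of \<open>\<E>\<close> (\<open>finitely_many_conjugates_of_quotients\<close>).

  For a homomorphism \<open>\<pi>\<close> and the preimages of countably many translates of a neighbourhood \<open>V\<close> of
  the identity in \<open>H\<close>, this says that \<open>\<pi> g\<close> lies in \<open>\<pi>(f)\<inverse> V V\<inverse> \<pi>(f)\<close> for some \<open>f \<in> F\<close>
  whenever \<open>g\<close> is close to the identity (\<open>universally_measurable_hom_conjugates\<close>). In
  a nonabelian target the conjugation by \<open>\<pi>(f)\<close> is the only obstacle to continuity, and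
  local compactness removes it by using the statement twice. With a relatively compact \<open>V\<close> and
  with \<open>Q = G\<close> it gives a neighbourhood \<open>W\<close> of the identity whose image lies in a compact set \<open>C\<close>.
  Given a neighbourhood \<open>U\<close> of the identity in \<open>H\<close>, there is a \<open>V\<close> with \<open>c\<inverse> V V\<inverse> c \<subseteq> U\<close>
  for all \<open>c \<in> C\<close> (\<open>uniform_conjugation_neighbourhood\<close>); the second use, with this \<open>V\<close> and with
  \<open>Q = W\<close>, shows that \<open>\<pi>\<close> maps a neighbourhood of the identity into \<open>U\<close>.\<close>

section \<open>Flipping one coordinate of a random binary sequence\<close>

definition coin_measure :: "(nat \<Rightarrow> bool) measure" where
  "coin_measure = PiM UNIV (\<lambda>_. measure_pmf (pmf_of_set UNIV))"

definition flip :: "nat \<Rightarrow> (nat \<Rightarrow> bool) \<Rightarrow> nat \<Rightarrow> bool" where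
  "flip n \<alpha> = \<alpha>(n := \<not> \<alpha> n)"

lemma prob_space_coin_measure: "prob_space coin_measure"
  unfolding coin_measure_def by (intro prob_space_PiM prob_space_measure_pmf)

lemma space_coin_measure [simp]: "space coin_measure = UNIV"
  by (simp add: coin_measure_def space_PiM PiE_def)

lemma measurable_coordinate [measurable]: "(\<lambda>\<alpha>. \<alpha> n) \<in> coin_measure \<rightarrow>\<^sub>M count_space UNIV"
  unfolding coin_measure_def
  using measurable_component_singleton[of n UNIV "\<lambda>_::nat. measure_pmf (pmf_of_set (UNIV::bool set))"]
  by (simp add: measurable_def)

lemma measurable_flip [measurable]: "flip n \<in> coin_measure \<rightarrow>\<^sub>M coin_measure"
proof -
  have "(\<lambda>\<alpha>. flip n \<alpha> k) \<in> coin_measure \<rightarrow>\<^sub>M measure_pmf (pmf_of_set (UNIV::bool set))" for k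
  proof -
    have "(\<lambda>\<alpha>. flip n \<alpha> k) = (\<lambda>\<alpha>. if k = n then \<not> \<alpha> k else \<alpha> k)"
      by (auto simp: flip_def)
    also have "\<dots> \<in> coin_measure \<rightarrow>\<^sub>M count_space UNIV" by measurable
    finally show ?thesis by (simp add: measurable_def)
  qed
  then have "(\<lambda>\<alpha>. \<lambda>k\<in>UNIV. flip n \<alpha> k) \<in> coin_measure \<rightarrow>\<^sub>M coin_measure"
    by (subst (2) coin_measure_def) (rule measurable_restrict)
  then show ?thesis by (simp add: restrict_UNIV)
qed

lemma distr_flip: "distr coin_measure coin_measure (flip n) = coin_measure"
proof -
  interpret product_prob_space "\<lambda>_::nat. measure_pmf (pmf_of_set (UNIV::bool set))" UNIV
    by unfold_locales
  let ?p = "\<lambda>_::nat. measure_pmf (pmf_of_set (UNIV::bool set))"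
  have not_invariant: "emeasure (measure_pmf (pmf_of_set UNIV)) (Not -` A) =
      emeasure (measure_pmf (pmf_of_set UNIV)) A" for A :: "bool set"
  proof -
    have "map_pmf Not (pmf_of_set UNIV) = pmf_of_set (UNIV::bool set)"
      by (rule map_pmf_of_set_bij_betw) (auto simp: bij_betw_def inj_on_def intro: image_eqI[of _ _ "\<not> _"])
    then show ?thesis by (metis emeasure_map_pmf)
  qed
  have "distr coin_measure coin_measure (flip n) = PiM UNIV ?p"
  proof (rule PiM_eq)
    fix J :: "nat set" and F :: "nat \<Rightarrow> bool set"
    assume J: "finite J"
    have cylinder: "prod_emb UNIV ?p J (Pi\<^sub>E J X) = {\<alpha>. \<forall>j\<in>J. \<alpha> j \<in> X j}" for X :: "nat \<Rightarrow> bool set"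
      by (auto simp: prod_emb_def space_PiM PiE_def Pi_iff)
    define F' where "F' = (\<lambda>j. if j = n then Not -` F j else F j)"
    have "prod_emb UNIV ?p J (Pi\<^sub>E J F) \<in> sets coin_measure"
      unfolding coin_measure_def by (rule sets_PiM_I) (auto simp: J)
    then have "emeasure (distr coin_measure coin_measure (flip n)) (prod_emb UNIV ?p J (Pi\<^sub>E J F))
        = emeasure coin_measure (flip n -` prod_emb UNIV ?p J (Pi\<^sub>E J F))"
      by (subst emeasure_distr) auto
    also have "flip n -` prod_emb UNIV ?p J (Pi\<^sub>E J F) = prod_emb UNIV ?p J (Pi\<^sub>E J F')"
      unfolding cylinder by (auto simp: F'_def flip_def split: if_splits)
    also have "emeasure coin_measure \<dots> = (\<Prod>j\<in>J. emeasure (?p j) (F' j))"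
      unfolding coin_measure_def by (rule emeasure_PiM_emb) (auto simp: J)
    also have "\<dots> = (\<Prod>j\<in>J. emeasure (?p j) (F j))"
      by (rule prod.cong) (auto simp: F'_def not_invariant)
    finally show "emeasure (distr coin_measure coin_measure (flip n)) (prod_emb UNIV ?p J (Pi\<^sub>E J F))
      = (\<Prod>j\<in>J. emeasure (?p j) (F j))" .
  qed (simp add: coin_measure_def)
  then show ?thesis by (simp add: coin_measure_def)
qed

lemma measure_flip_vimage:
  assumes [measurable]: "B \<in> sets coin_measure"
  shows "measure coin_measure (flip n -` B) = measure coin_measure B"
proof -
  have "measure (distr coin_measure coin_measure (flip n)) B = measure coin_measure (flip n -` B)"
    by (subst measure_distr) auto
  then show ?thesis by (simp add: distr_flip)
qed

text \<open>A cylinder does not see the \<open>n\<close>-th coordinate once \<open>n\<close> is large, so there the difference is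
  eventually empty. The property passes to complements because \<^term>\<open>flip n\<close> preserves the
  measure, and to disjoint countable unions by dominated convergence: the \<open>i\<close>-th difference is
  bounded by the measure of the \<open>i\<close>-th set, and these measures are summable.\<close>

lemma measure_diff_flip_tendsto_0:
  assumes "B \<in> sets coin_measure"
  shows "(\<lambda>n. measure coin_measure (B - flip n -` B)) \<longlonglongrightarrow> 0"
proof -
  interpret prob_space coin_measure by (rule prob_space_coin_measure)
  let ?p = "\<lambda>_::nat. measure_pmf (pmf_of_set (UNIV::bool set))"
  let ?\<Omega> = "\<Pi>\<^sub>E i\<in>UNIV. space (?p i)"
  have sets_eq: "sets coin_measure = sigma_sets ?\<Omega> (prod_algebra UNIV ?p)"
    by (simp add: coin_measure_def sets_PiM)
  have flip_sets: "flip n -` A \<in> sets coin_measure" if "A \<in> sets coin_measure" for n A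
    using measurable_sets[OF measurable_flip that] by simp
  have \<Omega>: "?\<Omega> = UNIV" by auto
  from assms have B: "B \<in> sigma_sets ?\<Omega> (prod_algebra UNIV ?p)" by (simp add: sets_eq)
  show ?thesis
    using Int_stable_prod_algebra prod_algebra_sets_into_space B
  proof (induction rule: sigma_sets_induct_disjoint)
    case (basic A)
    then obtain J F where J: "finite J" and A: "A = prod_emb UNIV ?p J (Pi\<^sub>E J F)"
      by (elim prod_algebraE) auto
    have "A - flip n -` A = {}" if "n > Max (insert 0 J)" for n
    proof -
      have "n \<notin> J" using that J by (meson Max_ge finite_insert insertI2 leD)
      then show ?thesis
        unfolding A by (auto simp: prod_emb_def space_PiM PiE_def flip_def)
    qed
    then have "measure coin_measure (A - flip n -` A) = 0" if "Suc (Max (insert 0 J)) \<le> n" for n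
      using that by (metis Suc_le_eq measure_empty)
    then have "eventually (\<lambda>n. measure coin_measure (A - flip n -` A) = 0) sequentially"
      by (rule eventually_sequentiallyI)
    then show ?case by (rule tendsto_eventually)
  next
    case empty
    then show ?case by simp
  next
    case (compl A)
    then have A: "A \<in> sets coin_measure" by (simp add: sets_eq)
    have "measure coin_measure ((?\<Omega> - A) - flip n -` (?\<Omega> - A)) =
        measure coin_measure (A - flip n -` A)" for n
    proof -
      have "measure coin_measure ((?\<Omega> - A) - flip n -` (?\<Omega> - A)) = measure coin_measure (flip n -` A - A)"
        unfolding \<Omega> by (rule arg_cong[where f = "measure coin_measure"]) auto
      also have "\<dots> = measure coin_measure (flip n -` A) - measure coin_measure (flip n -` A \<inter> A)"
        using A flip_sets[OF A] by (rule_tac finite_measure_Diff') auto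
      also have "\<dots> = measure coin_measure A - measure coin_measure (A \<inter> flip n -` A)"
        using A by (simp add: measure_flip_vimage Int_commute)
      also have "\<dots> = measure coin_measure (A - flip n -` A)"
        using A flip_sets[OF A] by (rule_tac finite_measure_Diff'[symmetric]) auto
      finally show ?thesis .
    qed
    with compl show ?case by simp
  next
    case (union A)
    then have A: "A i \<in> sets coin_measure" for i by (auto simp: sets_eq)
    let ?D = "\<lambda>n i. measure coin_measure (A i - flip n -` A i)"
    have summ: "summable (\<lambda>i. measure coin_measure (A i))"
      using finite_measure_UNION[of A] union(1) image_subsetI[of UNIV A, OF A] by (simp add: sums_iff)
    have D_le: "?D n i \<le> measure coin_measure (A i)" for n i
      using A by (intro finite_measure_mono) auto
    have lim: "(\<lambda>n. \<Sum>i. ?D n i) \<longlonglongrightarrow> (\<Sum>i. 0)"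
    proof (rule tannerys_theorem[where M = "\<lambda>i. measure coin_measure (A i)", THEN conjunct2, THEN conjunct2])
      show "(\<lambda>n. ?D n i) \<longlonglongrightarrow> 0" for i by (rule union(3))
      show "\<forall>\<^sub>F (i, n) in sequentially \<times>\<^sub>F sequentially. norm (?D n i) \<le> measure coin_measure (A i)"
        by (rule always_eventually) (use D_le in auto)
    qed (use summ in simp_all)
    have "norm (measure coin_measure (\<Union>(range A) - flip n -` \<Union>(range A))) \<le> (\<Sum>i. ?D n i)" for n
    proof -
      have "measure coin_measure (\<Union>(range A) - flip n -` \<Union>(range A)) \<le>
          measure coin_measure (\<Union>i. A i - flip n -` A i)"
        by (intro finite_measure_mono sets.countable_UN) (use A flip_sets[OF A] in auto)
      also have "\<dots> \<le> (\<Sum>i. ?D n i)"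
      proof (rule finite_measure_subadditive_countably)
        show "range (\<lambda>i. A i - flip n -` A i) \<subseteq> sets coin_measure"
          using A flip_sets[OF A] by blast
        show "summable (\<lambda>i. ?D n i)"
          by (rule summable_comparison_test'[OF summ]) (simp add: D_le)
      qed
      finally show ?thesis by simp
    qed
    then show ?case
      by (rule Lim_null_comparison[OF always_eventually, OF allI]) (use lim in simp)
  qed
qed

text \<open>The counterpart of Steinhaus' theorem for the group of binary sequences: for large \<open>n\<close> the
  \<open>n\<close>-th unit vector is a difference of two elements of the given set. Since flipping is an
  involution, the sequence that has the value \<^term>\<open>True\<close> at \<open>n\<close> may be listed first.\<close>

lemma flip_pair_in_positive_set:
  assumes B: "B \<in> sets coin_measure" and pos: "measure coin_measure B > 0"
  obtains n \<alpha> where "\<alpha> \<in> B" "flip n \<alpha> \<in> B" "\<alpha> n"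
proof -
  have "eventually (\<lambda>n. measure coin_measure (B - flip n -` B) < measure coin_measure B) sequentially"
    using measure_diff_flip_tendsto_0[OF B] pos by (rule order_tendstoD)
  then obtain n where "measure coin_measure (B - flip n -` B) < measure coin_measure B"
    by (auto simp: eventually_sequentially)
  then have "B - flip n -` B \<noteq> B" by auto
  then obtain \<alpha> where \<alpha>: "\<alpha> \<in> B" "flip n \<alpha> \<in> B" by auto
  moreover have "flip n (flip n \<alpha>) = \<alpha>" "flip n \<alpha> n \<longleftrightarrow> \<not> \<alpha> n"
    by (auto simp: flip_def)
  ultimately show ?thesis
    using that[of \<alpha> n] that[of "flip n \<alpha>" n] by auto
qed

section \<open>Measurability of limits and of pullbacks\<close>

text \<open>The points after stage \<open>m\<close> stay within \<open>2 * (1/2) ^ m\<close> of the \<open>m\<close>-th one. Hence the limit lies in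
  an open set \<open>U\<close> exactly if, for some \<open>m\<close>, the closed ball of that radius around the \<open>m\<close>-th point
  is contained in \<open>U\<close>, a condition on the \<open>m\<close>-th function alone. The functions are required to be
  measurable for the discrete structure so that no property of that set of centres matters; the
  partial products below take only finitely many values.\<close>

lemma (in Metric_space) measurable_fast_limit:
  fixes f :: "nat \<Rightarrow> 'w \<Rightarrow> 'a"
  assumes complete: mcomplete
    and meas: "\<And>n. f n \<in> N \<rightarrow>\<^sub>M count_space UNIV"
    and carrier: "\<And>n w. f n w \<in> M"
    and fast: "\<And>n w. d (f n w) (f (Suc n) w) \<le> (1/2) ^ n"
  obtains l where "\<And>w. limitin mtopology (\<lambda>n. f n w) (l w) sequentially"
    and "l \<in> N \<rightarrow>\<^sub>M sigma M {U. openin mtopology U}"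
proof -
  have diff: "d (f m w) (f (m + k) w) \<le> 2 * (1/2) ^ m - 2 * (1/2) ^ (m + k)" for m k w
  proof (induction k)
    case 0
    then show ?case using carrier by simp
  next
    case (Suc k)
    have "d (f m w) (f (m + Suc k) w) \<le> d (f m w) (f (m + k) w) + d (f (m + k) w) (f (Suc (m + k)) w)"
      using triangle[OF carrier carrier carrier] by (simp only: add_Suc_right)
    also have "\<dots> \<le> 2 * (1/2) ^ m - 2 * (1/2) ^ (m + k) + (1/2) ^ (m + k)"
      using Suc fast by (intro add_mono) auto
    also have "\<dots> = 2 * (1/2) ^ m - 2 * (1/2) ^ (m + Suc k)"
      by (simp only: add_Suc_right power_Suc)
    finally show ?case .
  qed
  have le: "d (f m w) (f n w) \<le> 2 * (1/2) ^ m" if mn: "m \<le> n" for m n w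
  proof -
    obtain k where "n = m + k" using le_Suc_ex[OF mn] by blast
    then have "d (f m w) (f n w) \<le> 2 * (1/2) ^ m - 2 * (1/2) ^ n" using diff[of m w k] by simp
    also have "\<dots> \<le> 2 * (1/2) ^ m" by simp
    finally show ?thesis .
  qed
  have small: "\<exists>m. 4 * (1/2::real) ^ m < \<epsilon>" if "\<epsilon> > 0" for \<epsilon> :: real
    using real_arch_pow_inv[of "\<epsilon>/4" "1/2"] that by (auto simp: field_simps)
  have "MCauchy (\<lambda>n. f n w)" for w
    unfolding MCauchy_def
  proof (intro conjI allI impI)
    fix \<epsilon> :: real assume "\<epsilon> > 0"
    then obtain m where m: "4 * (1/2::real) ^ m < \<epsilon>" using small by blast
    have "d (f n w) (f n' w) < \<epsilon>" if "m \<le> n" "m \<le> n'" for n n'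
      using triangle[OF carrier[of n w] carrier[of m w] carrier[of n' w]] le[OF that(1), of w] le[OF that(2), of w]
        m commute[of "f n w" "f m w"] by simp
    then show "\<exists>m. \<forall>n n'. m \<le> n \<longrightarrow> m \<le> n' \<longrightarrow> d (f n w) (f n' w) < \<epsilon>" by blast
  qed (use carrier in auto)
  then have "\<exists>l. limitin mtopology (\<lambda>n. f n w) l sequentially" for w
    using complete by (auto simp: mcomplete_def)
  then obtain l where l: "\<And>w. limitin mtopology (\<lambda>n. f n w) (l w) sequentially" by metis
  have l_in: "l w \<in> M" for w using l limitin_mspace by blast
  have l_near: "d (f m w) (l w) \<le> 2 * (1/2) ^ m" for m w
  proof (rule field_le_epsilon)
    fix \<epsilon> :: real assume "\<epsilon> > 0"
    then obtain k where k: "\<And>n. n \<ge> k \<Longrightarrow> d (f n w) (l w) < \<epsilon>"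
      using l[of w] unfolding limit_metric_sequentially by meson
    have "d (f m w) (l w) \<le> d (f m w) (f (max m k) w) + d (f (max m k) w) (l w)"
      using triangle carrier l_in by simp
    also have "\<dots> \<le> 2 * (1/2) ^ m + \<epsilon>"
      using le[of m "max m k" w] k[of "max m k"] by simp
    finally show "d (f m w) (l w) \<le> 2 * (1/2) ^ m + \<epsilon>" .
  qed
  have iff: "l w \<in> U \<longleftrightarrow> (\<exists>m. mcball (f m w) (2 * (1/2) ^ m) \<subseteq> U)" if "openin mtopology U" for U w
  proof
    assume "l w \<in> U"
    then obtain r where r: "r > 0" "mball (l w) r \<subseteq> U"
      using \<open>openin mtopology U\<close> by (auto simp: openin_mtopology)
    then obtain m where m: "4 * (1/2::real) ^ m < r" using small by blast
    have "mcball (f m w) (2 * (1/2) ^ m) \<subseteq> mball (l w) r"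
    proof
      fix x assume "x \<in> mcball (f m w) (2 * (1/2) ^ m)"
      then have x: "x \<in> M" "d (f m w) x \<le> 2 * (1/2) ^ m" by auto
      have "d (l w) x \<le> d (l w) (f m w) + d (f m w) x"
        using triangle carrier l_in x by simp
      also have "\<dots> < r" using x(2) l_near[of m w] m commute[of "f m w" "l w"] by simp
      finally show "x \<in> mball (l w) r" using x l_in by simp
    qed
    then show "\<exists>m. mcball (f m w) (2 * (1/2) ^ m) \<subseteq> U" using r by blast
  next
    assume "\<exists>m. mcball (f m w) (2 * (1/2) ^ m) \<subseteq> U"
    then show "l w \<in> U" using l_near l_in carrier by (auto simp: subset_iff)
  qed
  have "l \<in> N \<rightarrow>\<^sub>M sigma M {U. openin mtopology U}"
  proof (rule measurable_measure_of)
    show "{U. openin mtopology U} \<subseteq> Pow M"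
      using openin_subset by fastforce
    fix U assume "U \<in> {U. openin mtopology U}"
    then have "l -` U \<inter> space N = (\<Union>m. f m -` {x. mcball x (2 * (1/2) ^ m) \<subseteq> U} \<inter> space N)"
      using iff by auto
    also have "\<dots> \<in> sets N"
      by (intro sets.countable_UN image_subsetI measurable_sets[OF meas]) simp
    finally show "l -` U \<inter> space N \<in> sets N" .
  qed (use l_in in auto)
  then show ?thesis using l that by blast
qed

text \<open>Universal measurability is applied to the image measure: each member \<open>E\<close> of the cover contains a
  Borel set \<open>B E - Z E\<close> and differs from it only by points of a null set. If all preimages of these
  Borel sets were null, almost every point would be mapped outside the cover.\<close>

lemma countable_universally_measurable_cover_pullback:
  assumes "prob_space N"
    and \<Phi>: "\<Phi> \<in> N \<rightarrow>\<^sub>M sigma (topspace X) {U. openin X U}"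
    and "countable \<E>" and cover: "topspace X \<subseteq> \<Union>\<E>"
    and um: "\<And>E. E \<in> \<E> \<Longrightarrow> universally_measurable_set X E"
  obtains E B where "E \<in> \<E>" "B \<in> sets N" "measure N B > 0" "\<Phi> ` B \<subseteq> E"
proof -
  interpret prob_space N by fact
  let ?S = "sigma (topspace X) {U. openin X U}"
  define \<mu> where "\<mu> = distr N ?S \<Phi>"
  have opens: "{U. openin X U} \<subseteq> Pow (topspace X)" using openin_subset by auto
  have sets_\<mu>: "sets \<mu> = borel_sets_of X"
    using opens by (simp add: \<mu>_def borel_sets_of_def)
  have sets_S: "sets ?S = sets \<mu>" by (simp add: \<mu>_def)
  have "prob_space \<mu>" unfolding \<mu>_def by (rule prob_space_distr[OF \<Phi>])
  then have "\<exists>B Z. B \<in> borel_sets_of X \<and> Z \<in> null_sets \<mu> \<and> (E - B) \<union> (B - E) \<subseteq> Z" if "E \<in> \<E>" for E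
    using um[OF that] sets_\<mu> unfolding universally_measurable_set_def by blast
  then obtain B Z where BZ: "\<And>E. E \<in> \<E> \<Longrightarrow> B E \<in> borel_sets_of X"
      "\<And>E. E \<in> \<E> \<Longrightarrow> Z E \<in> null_sets \<mu>" "\<And>E. E \<in> \<E> \<Longrightarrow> (E - B E) \<union> (B E - E) \<subseteq> Z E"
    by metis
  let ?C = "\<lambda>E. \<Phi> -` (B E - Z E) \<inter> space N"
  have C: "?C E \<in> sets N" if "E \<in> \<E>" for E
  proof (rule measurable_sets[OF \<Phi>])
    show "B E - Z E \<in> sets ?S"
      using BZ(1,2)[OF that] unfolding sets_S sets_\<mu>[symmetric] by (intro sets.Diff) auto
  qed
  have "\<exists>E\<in>\<E>. measure N (?C E) > 0"
  proof (rule ccontr)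
    assume "\<not> ?thesis"
    then have "measure N (?C E) = 0" if "E \<in> \<E>" for E
      using that by (meson measure_nonneg order_antisym_conv not_le)
    then have "?C E \<in> null_sets N" if "E \<in> \<E>" for E
      using that C by (auto simp: null_sets_def emeasure_eq_measure)
    then have "AE x in N. x \<notin> ?C E" if "E \<in> \<E>" for E
      using that by (intro AE_not_in) auto
    moreover have "AE x in N. \<Phi> x \<notin> Z E" if "E \<in> \<E>" for E
      using AE_not_in[OF BZ(2)[OF that]] unfolding \<mu>_def by (rule AE_distrD[OF \<Phi>])
    ultimately have "AE x in N. x \<notin> ?C E \<and> \<Phi> x \<notin> Z E" if "E \<in> \<E>" for E
      using that by (intro AE_conjI)
    then have "AE x in N. \<forall>E\<in>\<E>. x \<notin> ?C E \<and> \<Phi> x \<notin> Z E"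
      using \<open>countable \<E>\<close> by (rule AE_ball_countable')
    then have "AE x in N. False"
    proof (rule AE_mp, intro AE_I2 impI)
      fix x assume x: "x \<in> space N" "\<forall>E\<in>\<E>. x \<notin> ?C E \<and> \<Phi> x \<notin> Z E"
      have "\<Phi> x \<in> topspace X"
        using measurable_space[OF \<Phi> x(1)] by (simp add: space_measure_of_conv)
      then obtain E where "E \<in> \<E>" "\<Phi> x \<in> E" using cover by blast
      then show False using BZ(3)[of E] x by blast
    qed
    then show False by simp
  qed
  then obtain E where E: "E \<in> \<E>" "measure N (?C E) > 0" by blast
  moreover have "\<Phi> ` ?C E \<subseteq> E" using BZ(3)[OF E(1)] by auto
  ultimately show ?thesis using C that by blast
qed

section \<open>Random products\<close>

text \<open>The ordered product of those \<open>g i\<close> with \<open>i < n\<close> for which \<open>\<alpha> i\<close> holds. New factors enter on the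
  right, so that they cancel in a right quotient.\<close>

primrec partial_product :: "('a, 'm) monoid_scheme \<Rightarrow> (nat \<Rightarrow> 'a) \<Rightarrow> (nat \<Rightarrow> bool) \<Rightarrow> nat \<Rightarrow> 'a" where
  "partial_product G g \<alpha> 0 = \<one>\<^bsub>G\<^esub>"
| "partial_product G g \<alpha> (Suc n) =
    (if \<alpha> n then partial_product G g \<alpha> n \<otimes>\<^bsub>G\<^esub> g n else partial_product G g \<alpha> n)"

lemma measurable_partial_product:
  "(\<lambda>\<alpha>. partial_product G g \<alpha> n) \<in> coin_measure \<rightarrow>\<^sub>M count_space UNIV"
proof (induction n)
  case (Suc n)
  have "(\<lambda>\<alpha>. partial_product G g \<alpha> n \<otimes>\<^bsub>G\<^esub> g n) \<in> coin_measure \<rightarrow>\<^sub>M count_space UNIV"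
    by (rule measurable_compose[OF Suc]) simp
  then show ?case using Suc by (auto intro!: measurable_If)
qed simp

lemma (in group) partial_product_closed:
  assumes "\<And>n. g n \<in> carrier G"
  shows "partial_product G g \<alpha> n \<in> carrier G"
  using assms by (induction n) auto

text \<open>The factors after position \<open>n\<close> agree and cancel; what remains is a conjugate of \<open>g n\<close> by the head
  of the product, which takes only finitely many values and is known before \<open>g n\<close> is chosen.\<close>

lemma (in group) partial_product_flip_quotient:
  assumes g: "\<And>n. g n \<in> carrier G" and "\<alpha> n" and "n < m"
  shows "partial_product G g \<alpha> m \<otimes> inv (partial_product G g (flip n \<alpha>) m) =
    partial_product G g \<alpha> n \<otimes> g n \<otimes> inv (partial_product G g \<alpha> n)"
proof -
  have same: "partial_product G g (flip n \<alpha>) k = partial_product G g \<alpha> k" if "k \<le> n" for k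
    using that by (induction k) (auto simp: flip_def)
  have "Suc n \<le> m" using \<open>n < m\<close> by simp
  then show ?thesis
  proof (induction m rule: dec_induct)
    case base
    have "\<not> flip n \<alpha> n" using \<open>\<alpha> n\<close> by (simp add: flip_def)
    then show ?case using \<open>\<alpha> n\<close> same[of n] by simp
  next
    case (step k)
    have "flip n \<alpha> k \<longleftrightarrow> \<alpha> k" using step by (simp add: flip_def)
    moreover have cancel: "g k \<otimes> (inv g k \<otimes> x) = x" if "x \<in> carrier G" for x
      using that g by (simp add: m_assoc[symmetric])
    ultimately show ?case
      using step.IH partial_product_closed[OF g] g
      by (cases "\<alpha> k") (simp_all add: inv_mult_group m_assoc)
  qed
qed

section \<open>Topological groups\<close>

lemma (in topological_group) continuous_map_mult:
  assumes "continuous_map X T f" "continuous_map X T g"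
  shows "continuous_map X T (\<lambda>x. f x \<otimes> g x)"
  using continuous_map_compose[OF continuous_map_pairedI[OF assms] continuous_mult]
  by (simp add: o_def)

lemma (in topological_group) continuous_map_inverse:
  assumes "continuous_map X T f"
  shows "continuous_map X T (\<lambda>x. inv (f x))"
  using continuous_map_compose[OF assms continuous_inv] by (simp add: o_def)

lemma (in topological_group) openin_mult_vimage:
  assumes "openin T U" "a \<in> carrier G" "b \<in> carrier G"
  shows "openin T {x \<in> carrier G. a \<otimes> x \<otimes> b \<in> U}"
proof -
  have "continuous_map T T (\<lambda>x. a \<otimes> x \<otimes> b)"
    using assms by (intro continuous_map_mult continuous_map_id[unfolded id_def])
      (simp_all add: topspace_eq_carrier)
  from openin_continuous_map_preimage[OF this assms(1)] show ?thesis
    by (simp add: topspace_eq_carrier)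
qed

text \<open>The map \<open>(c, v, w) \<mapsto> c\<inverse> v w\<inverse> c\<close> sends \<open>C \<times> {(1, 1)}\<close> to the identity, so compactness of \<open>C\<close>
  and the tube lemma give one neighbourhood that serves all of \<open>C\<close>.\<close>

lemma (in topological_group) uniform_conjugation_neighbourhood:
  assumes C: "compactin T C" and U: "openin T U" "\<one> \<in> U"
  obtains V where "openin T V" "\<one> \<in> V"
    and "\<And>c v w. c \<in> C \<Longrightarrow> v \<in> V \<Longrightarrow> w \<in> V \<Longrightarrow> inv c \<otimes> (v \<otimes> inv w) \<otimes> c \<in> U"
proof -
  let ?X = "prod_topology T (prod_topology T T)"
  let ?f = "\<lambda>z. inv (fst z) \<otimes> (fst (snd z) \<otimes> inv (snd (snd z))) \<otimes> fst z"
  have fst_c: "continuous_map ?X T fst" by (rule continuous_map_fst)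
  have snd_c: "continuous_map ?X (prod_topology T T) snd" by (rule continuous_map_snd)
  have "continuous_map ?X T (\<lambda>z. fst (snd z))" "continuous_map ?X T (\<lambda>z. snd (snd z))"
    using continuous_map_compose[OF snd_c continuous_map_fst]
      continuous_map_compose[OF snd_c continuous_map_snd] by (simp_all add: o_def)
  then have "continuous_map ?X T ?f"
    by (intro continuous_map_mult continuous_map_inverse fst_c)
  then have open_W: "openin ?X {z \<in> topspace ?X. ?f z \<in> U}"
    using U by (rule_tac openin_continuous_map_preimage)
  have C_sub: "C \<subseteq> carrier G"
    using compactin_subset_topspace[OF C] by (simp add: topspace_eq_carrier)
  have "C \<times> {(\<one>, \<one>)} \<subseteq> {z \<in> topspace ?X. ?f z \<in> U}"
    using C_sub U by (auto simp: topspace_eq_carrier)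
  then obtain A B where AB: "openin (prod_topology T T) B" "C \<subseteq> A" "(\<one>, \<one>) \<in> B"
      "A \<times> B \<subseteq> {z \<in> topspace ?X. ?f z \<in> U}"
    using tube_lemma_left[OF open_W C, of "(\<one>, \<one>)"] by (auto simp: topspace_eq_carrier)
  have "\<exists>V1 V2. openin T V1 \<and> openin T V2 \<and> \<one> \<in> V1 \<and> \<one> \<in> V2 \<and> V1 \<times> V2 \<subseteq> B"
    using AB(1,3) by (simp add: openin_prod_topology_alt)
  then obtain V1 V2 where V: "openin T V1" "openin T V2" "\<one> \<in> V1" "\<one> \<in> V2" "V1 \<times> V2 \<subseteq> B"
    by blast
  show ?thesis
  proof (rule that)
    show "openin T (V1 \<inter> V2)" "\<one> \<in> V1 \<inter> V2" using V by auto
    fix c v w assume "c \<in> C" "v \<in> V1 \<inter> V2" "w \<in> V1 \<inter> V2"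
    then have "(c, v, w) \<in> A \<times> B" using AB(2) V(5) by auto
    then show "inv c \<otimes> (v \<otimes> inv w) \<otimes> c \<in> U" using AB(4) by auto
  qed
qed

lemma continuous_hom_from_one:
  assumes "topological_group G TG" and "topological_group H TH"
    and \<pi>: "\<pi> \<in> hom G H"
    and at_one: "\<And>U. openin TH U \<Longrightarrow> \<one>\<^bsub>H\<^esub> \<in> U \<Longrightarrow>
      \<exists>W. openin TG W \<and> \<one>\<^bsub>G\<^esub> \<in> W \<and> \<pi> ` W \<subseteq> U"
  shows "continuous_map TG TH \<pi>"
proof -
  interpret G: topological_group G TG by fact
  interpret H: topological_group H TH by fact
  interpret group_hom G H \<pi> using \<pi> by unfold_locales
  have "openin TG {x \<in> topspace TG. \<pi> x \<in> U}" if U: "openin TH U" for U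
  proof (subst openin_subopen, intro ballI)
    fix x assume "x \<in> {x \<in> topspace TG. \<pi> x \<in> U}"
    then have x: "x \<in> carrier G" "\<pi> x \<in> U" by (auto simp: G.topspace_eq_carrier)
    have "openin TH {h \<in> carrier H. \<pi> x \<otimes>\<^bsub>H\<^esub> h \<otimes>\<^bsub>H\<^esub> \<one>\<^bsub>H\<^esub> \<in> U}"
      using U x by (intro H.openin_mult_vimage) auto
    moreover have "\<one>\<^bsub>H\<^esub> \<in> {h \<in> carrier H. \<pi> x \<otimes>\<^bsub>H\<^esub> h \<otimes>\<^bsub>H\<^esub> \<one>\<^bsub>H\<^esub> \<in> U}"
      using x by simp
    ultimately obtain W where W: "openin TG W" "\<one>\<^bsub>G\<^esub> \<in> W"
        "\<pi> ` W \<subseteq> {h \<in> carrier H. \<pi> x \<otimes>\<^bsub>H\<^esub> h \<otimes>\<^bsub>H\<^esub> \<one>\<^bsub>H\<^esub> \<in> U}"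
      using at_one by meson
    let ?T = "{y \<in> carrier G. inv\<^bsub>G\<^esub> x \<otimes>\<^bsub>G\<^esub> y \<otimes>\<^bsub>G\<^esub> \<one>\<^bsub>G\<^esub> \<in> W}"
    have "openin TG ?T" using W x by (intro G.openin_mult_vimage) auto
    moreover have "x \<in> ?T" using W x by simp
    moreover have "?T \<subseteq> {x \<in> topspace TG. \<pi> x \<in> U}"
    proof
      fix y assume y: "y \<in> ?T"
      then have "inv\<^bsub>G\<^esub> x \<otimes>\<^bsub>G\<^esub> y \<in> W" using x by auto
      then have "\<pi> (inv\<^bsub>G\<^esub> x \<otimes>\<^bsub>G\<^esub> y) \<in> \<pi> ` W" by (rule imageI)
      then have "\<pi> x \<otimes>\<^bsub>H\<^esub> \<pi> (inv\<^bsub>G\<^esub> x \<otimes>\<^bsub>G\<^esub> y) \<in> U" using W(3) x by auto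
      moreover have "\<pi> x \<otimes>\<^bsub>H\<^esub> \<pi> (inv\<^bsub>G\<^esub> x \<otimes>\<^bsub>G\<^esub> y) = \<pi> (x \<otimes>\<^bsub>G\<^esub> (inv\<^bsub>G\<^esub> x \<otimes>\<^bsub>G\<^esub> y))"
        using x y by (subst hom_mult) auto
      moreover have "x \<otimes>\<^bsub>G\<^esub> (inv\<^bsub>G\<^esub> x \<otimes>\<^bsub>G\<^esub> y) = y"
        using x y by (simp add: G.m_assoc[symmetric])
      ultimately show "y \<in> {x \<in> topspace TG. \<pi> x \<in> U}"
        using y by (simp add: G.topspace_eq_carrier)
    qed
    ultimately show "\<exists>T. openin TG T \<and> x \<in> T \<and> T \<subseteq> {x \<in> topspace TG. \<pi> x \<in> U}" by blast
  qed
  then show ?thesis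
    by (auto simp: continuous_map_def G.topspace_eq_carrier H.topspace_eq_carrier)
qed

section \<open>Covers by universally measurable sets\<close>

text \<open>Suppose the conclusion fails. Then one can choose a sequence \<open>g\<close> converging to the identity so
  fast that the products \<open>g 0 ^ \<alpha> 0 * g 1 ^ \<alpha> 1 * \<dots>\<close> converge for all binary sequences \<open>\<alpha>\<close>, with
  all finite partial products in \<open>Q\<close>, and such that no conjugate of \<open>g n\<close> by one of the finitely
  many partial products of the earlier terms is a quotient of two elements of a common member of
  the cover. For random \<open>\<alpha>\<close>, one member \<open>E\<close> of the cover contains the product with positive
  probability, hence contains the products for some \<open>\<alpha>\<close> and for \<^term>\<open>flip n \<alpha>\<close>. The quotient of
  these two products is one of the excluded conjugates.

  That the conjugating elements can be taken from an arbitrary neighbourhood \<open>Q\<close> of the identity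
  is what the proof of continuity exploits.\<close>

lemma (in polish_group) finitely_many_conjugates_of_quotients:
  assumes "countable \<E>" and cover: "carrier G \<subseteq> \<Union>\<E>"
    and um: "\<And>E. E \<in> \<E> \<Longrightarrow> universally_measurable_set T E"
    and Q: "openin T Q" "\<one> \<in> Q"
  obtains F W where "finite F" "F \<subseteq> Q" "openin T W" "\<one> \<in> W"
    and "\<And>g. g \<in> W \<Longrightarrow> \<exists>f\<in>F. \<exists>E\<in>\<E>. \<exists>x\<in>E. \<exists>y\<in>E. f \<otimes> g \<otimes> inv f = x \<otimes> inv y"
proof (rule ccontr)
  note found = that
  assume contra: "\<not> thesis"
  \<comment> \<open>All quotients that the sequence has to avoid.\<close>
  define D where "D = {x \<otimes> inv y | x y E. E \<in> \<E> \<and> x \<in> E \<and> y \<in> E}"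
  have escape: "\<exists>g\<in>W. \<forall>f\<in>F. f \<otimes> g \<otimes> inv f \<notin> D"
    if FW: "finite F" "F \<subseteq> Q" "openin T W" "\<one> \<in> W" for F W
  proof (rule ccontr)
    assume "\<not> ?thesis"
    then have "\<And>g. g \<in> W \<Longrightarrow> \<exists>f\<in>F. \<exists>E\<in>\<E>. \<exists>x\<in>E. \<exists>y\<in>E. f \<otimes> g \<otimes> inv f = x \<otimes> inv y"
      unfolding D_def by blast
    from contra found[OF FW this] show False by (rule notE)
  qed
  obtain M d where "Metric_space M d" and complete: "Metric_space.mcomplete M d"
    and T: "T = Metric_space.mtopology M d"
    using polish unfolding polish_topology_def completely_metrizable_space_def by blast
  interpret Metric_space M d by fact
  have M: "M = carrier G" using topspace_eq_carrier by (simp add: T)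
  have Q_sub: "Q \<subseteq> carrier G" using openin_subset[OF Q(1)] topspace_eq_carrier by simp
  have step: "\<exists>g\<in>carrier G. \<forall>p\<in>P. p \<otimes> g \<in> Q \<and> d p (p \<otimes> g) \<le> (1/2) ^ n \<and> p \<otimes> g \<otimes> inv p \<notin> D"
    if P: "finite P" "P \<subseteq> Q" for P and n :: nat
  proof -
    \<comment> \<open>The trailing factor \<open>\<one>\<close> only makes the set an instance of a two-sided translate.\<close>
    let ?N = "\<lambda>p. {g \<in> carrier G. p \<otimes> g \<otimes> \<one> \<in> Q \<inter> mball p ((1/2) ^ n)}"
    let ?W = "topspace T \<inter> \<Inter>(?N ` P)"
    have "openin T (?N p)" if "p \<in> P" for p
      using that P Q Q_sub by (intro openin_mult_vimage openin_Int) (auto simp: T)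
    then have open_W: "openin T ?W"
      using P(1) by (cases "P = {}") (auto intro!: openin_Int openin_Inter)
    have "\<one> \<in> ?N p" if "p \<in> P" for p
    proof -
      have "p \<in> Q" "p \<in> carrier G" using that P(2) Q_sub by auto
      moreover have "p \<in> M" using \<open>p \<in> carrier G\<close> M by simp
      ultimately show ?thesis by simp
    qed
    then have "\<one> \<in> ?W" by (simp add: topspace_eq_carrier)
    from escape[OF P open_W this]
    obtain g where g: "g \<in> ?W" "\<forall>p\<in>P. p \<otimes> g \<otimes> inv p \<notin> D" ..
    then have g_carrier: "g \<in> carrier G" by (simp add: topspace_eq_carrier)
    show ?thesis
    proof (intro bexI ballI)
      fix p assume p: "p \<in> P"
      then have "p \<in> carrier G" using P(2) Q_sub by auto
      moreover have "p \<otimes> g \<otimes> \<one> \<in> Q \<inter> mball p ((1/2) ^ n)" using g(1) p by blast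
      ultimately show "p \<otimes> g \<in> Q \<and> d p (p \<otimes> g) \<le> (1/2) ^ n \<and> p \<otimes> g \<otimes> inv p \<notin> D"
        using g(2) g_carrier p by auto
    qed (rule g_carrier)
  qed
  \<comment> \<open>The recursion runs through the finite sets \<open>P n\<close> of partial products of the first \<open>n\<close> terms;
    the terms \<open>g n\<close> themselves are extracted afterwards.\<close>
  let ?step = "\<lambda>n g P. g \<in> carrier G \<and>
    (\<forall>p\<in>P. p \<otimes> g \<in> Q \<and> d p (p \<otimes> g) \<le> (1/2) ^ n \<and> p \<otimes> g \<otimes> inv p \<notin> D)"
  have "\<exists>P. \<forall>n::nat. (finite (P n) \<and> P n \<subseteq> Q \<and> (n = 0 \<longrightarrow> P n = {\<one>})) \<and>
      (\<exists>g. ?step n g (P n) \<and> P (Suc n) = P n \<union> (\<lambda>p. p \<otimes> g) ` P n)"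
  proof (rule dependent_nat_choice)
    show "\<exists>P. finite P \<and> P \<subseteq> Q \<and> ((0::nat) = 0 \<longrightarrow> P = {\<one>})"
      using Q by auto
  next
    fix P and n :: nat assume P: "finite P \<and> P \<subseteq> Q \<and> (n = 0 \<longrightarrow> P = {\<one>})"
    then obtain g where "?step n g P" using step[of P n] by blast
    then show "\<exists>P'. (finite P' \<and> P' \<subseteq> Q \<and> (Suc n = 0 \<longrightarrow> P' = {\<one>})) \<and>
        (\<exists>g. ?step n g P \<and> P' = P \<union> (\<lambda>p. p \<otimes> g) ` P)"
      using P by (intro exI[of _ "P \<union> (\<lambda>p. p \<otimes> g) ` P"] conjI exI[of _ g]) auto
  qed
  then obtain P where "\<forall>n::nat. (finite (P n) \<and> P n \<subseteq> Q \<and> (n = 0 \<longrightarrow> P n = {\<one>})) \<and>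
      (\<exists>g. ?step n g (P n) \<and> P (Suc n) = P n \<union> (\<lambda>p. p \<otimes> g) ` P n)" ..
  then have P_0: "P 0 = {\<one>}"
    and "\<forall>n. \<exists>g. ?step n g (P n) \<and> P (Suc n) = P n \<union> (\<lambda>p. p \<otimes> g) ` P n"
    by simp_all
  from choice[OF this(2)] obtain g where g: "\<And>n. ?step n (g n) (P n)"
    and P_Suc: "\<And>n. P (Suc n) = P n \<union> (\<lambda>p. p \<otimes> g n) ` P n"
    by blast
  have g_carrier: "g n \<in> carrier G" for n using g by blast
  let ?f = "\<lambda>n \<alpha>. partial_product G g \<alpha> n"
  have f_P: "?f n \<alpha> \<in> P n" for n \<alpha>
    by (induction n) (auto simp: P_0 P_Suc)
  have f_carrier: "?f n \<alpha> \<in> carrier G" for n \<alpha>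
    using g_carrier by (rule partial_product_closed)
  have fast: "d (?f n \<alpha>) (?f (Suc n) \<alpha>) \<le> (1/2) ^ n" for n \<alpha>
  proof -
    have "d (?f n \<alpha>) (?f n \<alpha> \<otimes> g n) \<le> (1/2) ^ n" using g[of n] f_P[of \<alpha> n] by blast
    moreover have "d (?f n \<alpha>) (?f n \<alpha>) \<le> (1/2) ^ n" using f_carrier[of \<alpha> n] M by simp
    ultimately show ?thesis by simp
  qed
  have f_M: "?f n \<alpha> \<in> M" for n \<alpha> using f_carrier M by simp
  obtain \<Phi> where "\<And>\<alpha>. limitin mtopology (\<lambda>n. ?f n \<alpha>) (\<Phi> \<alpha>) sequentially"
    and "\<Phi> \<in> coin_measure \<rightarrow>\<^sub>M sigma M {U. openin mtopology U}"
    by (rule measurable_fast_limit[of ?f, OF complete measurable_partial_product f_M fast]) (rule that)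
  then have lim: "\<And>\<alpha>. limitin T (\<lambda>n. ?f n \<alpha>) (\<Phi> \<alpha>) sequentially"
    and \<Phi>: "\<Phi> \<in> coin_measure \<rightarrow>\<^sub>M sigma (topspace T) {U. openin T U}"
    unfolding T by simp_all
  have cover': "topspace T \<subseteq> \<Union>\<E>" using cover topspace_eq_carrier by simp
  obtain E B where EB: "E \<in> \<E>" "B \<in> sets coin_measure" "measure coin_measure B > 0" "\<Phi> ` B \<subseteq> E"
    by (rule countable_universally_measurable_cover_pullback
        [OF prob_space_coin_measure \<Phi> \<open>countable \<E>\<close> cover' um]) (assumption, rule that)
  obtain n \<alpha> where \<alpha>: "\<alpha> \<in> B" "flip n \<alpha> \<in> B" "\<alpha> n"
    by (rule flip_pair_in_positive_set[OF EB(2,3)]) (rule that)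
  have lim_pair: "limitin (prod_topology T T) (\<lambda>m. (?f m \<alpha>, ?f m (flip n \<alpha>))) (\<Phi> \<alpha>, \<Phi> (flip n \<alpha>)) sequentially"
    using lim by (simp add: limitin_pairwise o_def)
  have "continuous_map (prod_topology T T) T (\<lambda>z. fst z \<otimes> inv (snd z))"
    by (intro continuous_map_mult continuous_map_inverse continuous_map_fst continuous_map_snd)
  from continuous_map_limit[OF this lim_pair] have lim_quotient: "limitin T (\<lambda>m. ?f m \<alpha> \<otimes> inv (?f m (flip n \<alpha>)))
      (\<Phi> \<alpha> \<otimes> inv (\<Phi> (flip n \<alpha>))) sequentially"
    by (simp add: o_def)
  have "eventually (\<lambda>m. ?f n \<alpha> \<otimes> g n \<otimes> inv (?f n \<alpha>) =
      ?f m \<alpha> \<otimes> inv (?f m (flip n \<alpha>))) sequentially"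
  proof (rule eventually_sequentiallyI)
    fix m assume "Suc n \<le> m"
    then have "n < m" by simp
    from partial_product_flip_quotient[of g \<alpha> n m, OF g_carrier \<alpha>(3) this]
    show "?f n \<alpha> \<otimes> g n \<otimes> inv (?f n \<alpha>) = ?f m \<alpha> \<otimes> inv (?f m (flip n \<alpha>))" by (rule sym)
  qed
  moreover have "limitin T (\<lambda>m. ?f n \<alpha> \<otimes> g n \<otimes> inv (?f n \<alpha>)) (?f n \<alpha> \<otimes> g n \<otimes> inv (?f n \<alpha>)) sequentially"
    using f_carrier g_carrier topspace_eq_carrier by simp
  ultimately have "limitin T (\<lambda>m. ?f m \<alpha> \<otimes> inv (?f m (flip n \<alpha>)))
      (?f n \<alpha> \<otimes> g n \<otimes> inv (?f n \<alpha>)) sequentially"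
    by (rule limitin_transform_eventually)
  with lim_quotient have "\<Phi> \<alpha> \<otimes> inv (\<Phi> (flip n \<alpha>)) = ?f n \<alpha> \<otimes> g n \<otimes> inv (?f n \<alpha>)"
    by (rule limitin_Hausdorff_unique) (simp_all add: T Hausdorff_space_mtopology)
  moreover have "\<Phi> \<alpha> \<otimes> inv (\<Phi> (flip n \<alpha>)) \<in> D"
    unfolding D_def using EB(1,4) \<alpha>(1,2) by blast
  moreover have "?f n \<alpha> \<otimes> g n \<otimes> inv (?f n \<alpha>) \<notin> D" using g[of n] f_P[of \<alpha> n] by blast
  ultimately show False by simp
qed

section \<open>Automatic continuity\<close>

text \<open>By second countability, countably many translates \<open>V h\<close> cover \<open>H\<close>, and their preimages under
  \<open>\<pi>\<close> are universally measurable. The cover of \<open>G\<close> by these preimages has the advantage that a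
  quotient of two elements of one member is mapped into \<open>V V\<inverse>\<close>, independently of \<open>h\<close>.\<close>

lemma universally_measurable_hom_conjugates:
  assumes "polish_group G TG" and "topological_group H TH" and "second_countable TH"
    and \<pi>: "\<pi> \<in> hom G H"
    and um: "universally_measurable_map TG TH \<pi>"
    and Q: "openin TG Q" "\<one>\<^bsub>G\<^esub> \<in> Q" and V: "openin TH V" "\<one>\<^bsub>H\<^esub> \<in> V"
  obtains F W where "finite F" "F \<subseteq> Q" "openin TG W" "\<one>\<^bsub>G\<^esub> \<in> W"
    and "\<And>g. g \<in> W \<Longrightarrow> \<exists>f\<in>F. \<exists>v\<in>V. \<exists>w\<in>V.
      \<pi> g = inv\<^bsub>H\<^esub> (\<pi> f) \<otimes>\<^bsub>H\<^esub> (v \<otimes>\<^bsub>H\<^esub> inv\<^bsub>H\<^esub> w) \<otimes>\<^bsub>H\<^esub> \<pi> f"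
proof -
  interpret G: polish_group G TG by fact
  interpret H: topological_group H TH by fact
  interpret group_hom G H \<pi> using \<pi> by unfold_locales
  let ?V = "\<lambda>h. {y \<in> carrier H. \<one>\<^bsub>H\<^esub> \<otimes>\<^bsub>H\<^esub> y \<otimes>\<^bsub>H\<^esub> inv\<^bsub>H\<^esub> h \<in> V}"
  have open_V: "openin TH (?V h)" if "h \<in> carrier H" for h
    using V that by (intro H.openin_mult_vimage) auto
  have "topspace TH \<subseteq> \<Union>(?V ` carrier H)"
  proof
    fix y assume "y \<in> topspace TH"
    then have "y \<in> ?V y" "y \<in> carrier H" using V by (simp_all add: H.topspace_eq_carrier)
    then show "y \<in> \<Union>(?V ` carrier H)" by blast
  qed
  moreover have "\<forall>U\<in>?V ` carrier H. openin TH U" using open_V by blast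
  ultimately obtain \<V> where \<V>: "countable \<V>" "\<V> \<subseteq> ?V ` carrier H" "topspace TH \<subseteq> \<Union>\<V>"
    using second_countable_imp_Lindelof_space[OF assms(3)] unfolding Lindelof_space_alt by meson
  let ?E = "\<lambda>U. {x \<in> topspace TG. \<pi> x \<in> U}"
  have countable_E: "countable (?E ` \<V>)" using \<V>(1) by simp
  have cover_E: "carrier G \<subseteq> \<Union>(?E ` \<V>)"
  proof
    fix x assume x: "x \<in> carrier G"
    then have "\<pi> x \<in> topspace TH" by (simp add: H.topspace_eq_carrier)
    then obtain U where "U \<in> \<V>" "\<pi> x \<in> U" using \<V>(3) by blast
    then show "x \<in> \<Union>(?E ` \<V>)" using x by (auto simp: G.topspace_eq_carrier)
  qed
  have um_E: "universally_measurable_set TG E" if "E \<in> ?E ` \<V>" for E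
  proof -
    obtain U where U: "U \<in> \<V>" "E = ?E U" using \<open>E \<in> ?E ` \<V>\<close> by (rule imageE)
    then obtain h where "h \<in> carrier H" "U = ?V h" using \<V>(2) by blast
    then have "openin TH U" using open_V by simp
    then show ?thesis using um U(2) by (simp add: universally_measurable_map_def)
  qed
  obtain F W where FW: "finite F" "F \<subseteq> Q" "openin TG W" "\<one>\<^bsub>G\<^esub> \<in> W"
    and conj: "\<And>g. g \<in> W \<Longrightarrow> \<exists>f\<in>F. \<exists>E\<in>?E ` \<V>. \<exists>x\<in>E. \<exists>y\<in>E.
      f \<otimes>\<^bsub>G\<^esub> g \<otimes>\<^bsub>G\<^esub> inv\<^bsub>G\<^esub> f = x \<otimes>\<^bsub>G\<^esub> inv\<^bsub>G\<^esub> y"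
    by (rule G.finitely_many_conjugates_of_quotients[OF countable_E cover_E um_E Q]) (assumption, rule that)
  have sub: "Q \<subseteq> carrier G" "W \<subseteq> carrier G" "V \<subseteq> carrier H"
    using openin_subset[OF Q(1)] openin_subset[OF FW(3)] openin_subset[OF V(1)]
    by (simp_all add: G.topspace_eq_carrier H.topspace_eq_carrier)
  show ?thesis
  proof (rule that[OF FW])
    fix g assume g: "g \<in> W"
    then obtain f U x y where f: "f \<in> F" and U: "U \<in> \<V>"
      and xy: "x \<in> topspace TG" "y \<in> topspace TG" "\<pi> x \<in> U" "\<pi> y \<in> U"
      and eq: "f \<otimes>\<^bsub>G\<^esub> g \<otimes>\<^bsub>G\<^esub> inv\<^bsub>G\<^esub> f = x \<otimes>\<^bsub>G\<^esub> inv\<^bsub>G\<^esub> y"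
      using conj[OF g] by blast
    obtain h where h: "h \<in> carrier H" "U = ?V h" using U \<V>(2) by blast
    have carr: "f \<in> carrier G" "g \<in> carrier G" "x \<in> carrier G" "y \<in> carrier G"
      using f FW(2) sub g xy by (auto simp: G.topspace_eq_carrier)
    define v w where "v = \<pi> x \<otimes>\<^bsub>H\<^esub> inv\<^bsub>H\<^esub> h" and "w = \<pi> y \<otimes>\<^bsub>H\<^esub> inv\<^bsub>H\<^esub> h"
    have vw: "v \<in> V" "w \<in> V" using xy h carr by (auto simp: v_def w_def)
    have "inv\<^bsub>H\<^esub> h \<otimes>\<^bsub>H\<^esub> (h \<otimes>\<^bsub>H\<^esub> z) = z" if "z \<in> carrier H" for z
      using that h by (simp add: H.m_assoc[symmetric])
    then have "v \<otimes>\<^bsub>H\<^esub> inv\<^bsub>H\<^esub> w = \<pi> x \<otimes>\<^bsub>H\<^esub> inv\<^bsub>H\<^esub> \<pi> y"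
      using carr h by (simp add: v_def w_def H.inv_mult_group H.m_assoc)
    also have "\<dots> = \<pi> (f \<otimes>\<^bsub>G\<^esub> g \<otimes>\<^bsub>G\<^esub> inv\<^bsub>G\<^esub> f)"
      using carr by (simp add: eq)
    also have "\<dots> = \<pi> f \<otimes>\<^bsub>H\<^esub> \<pi> g \<otimes>\<^bsub>H\<^esub> inv\<^bsub>H\<^esub> \<pi> f"
      using carr by simp
    finally have "inv\<^bsub>H\<^esub> (\<pi> f) \<otimes>\<^bsub>H\<^esub> (v \<otimes>\<^bsub>H\<^esub> inv\<^bsub>H\<^esub> w) \<otimes>\<^bsub>H\<^esub> \<pi> f =
        inv\<^bsub>H\<^esub> (\<pi> f) \<otimes>\<^bsub>H\<^esub> (\<pi> f \<otimes>\<^bsub>H\<^esub> \<pi> g \<otimes>\<^bsub>H\<^esub> inv\<^bsub>H\<^esub> \<pi> f) \<otimes>\<^bsub>H\<^esub> \<pi> f" by simp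
    also have "\<dots> = (inv\<^bsub>H\<^esub> (\<pi> f) \<otimes>\<^bsub>H\<^esub> \<pi> f) \<otimes>\<^bsub>H\<^esub> \<pi> g \<otimes>\<^bsub>H\<^esub> (inv\<^bsub>H\<^esub> \<pi> f \<otimes>\<^bsub>H\<^esub> \<pi> f)"
      using carr by (simp only: H.m_assoc hom_closed H.inv_closed H.m_closed)
    also have "\<dots> = \<pi> g" using carr by simp
    finally show "\<exists>f\<in>F. \<exists>v\<in>V. \<exists>w\<in>V.
      \<pi> g = inv\<^bsub>H\<^esub> (\<pi> f) \<otimes>\<^bsub>H\<^esub> (v \<otimes>\<^bsub>H\<^esub> inv\<^bsub>H\<^esub> w) \<otimes>\<^bsub>H\<^esub> \<pi> f"
      using f vw by (intro bexI) (rule sym)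
  qed
qed

theorem theorem2:
  fixes G :: "('a, 'm) monoid_scheme" and TG :: "'a topology"
    and H :: "('b, 'n) monoid_scheme" and TH :: "'b topology"
    and \<pi> :: "'a \<Rightarrow> 'b"
  assumes "polish_group G TG"
    and "locally_compact_group H TH"
    and "second_countable TH"
    and "\<pi> \<in> hom G H"
    and "universally_measurable_map TG TH \<pi>"
  shows "continuous_map TG TH \<pi>"
proof -
  interpret G: polish_group G TG by fact
  interpret H: locally_compact_group H TH by fact
  interpret group_hom G H \<pi> using assms(4) by unfold_locales
  note TH_group = H.topological_group_axioms
  note conjugates = universally_measurable_hom_conjugates[OF assms(1) TH_group assms(3-5)]
  \<comment> \<open>First application, with \<open>V\<close> relatively compact: some neighbourhood \<open>W\<close> of the identity has
    relatively compact image.\<close>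
  obtain V K where V: "openin TH V" "\<one>\<^bsub>H\<^esub> \<in> V" and K: "compactin TH K" "V \<subseteq> K"
    using H.locally_compact unfolding locally_compact_space_def
    by (metis H.one_closed H.topspace_eq_carrier)
  have "openin TG (carrier G)" "\<one>\<^bsub>G\<^esub> \<in> carrier G"
    using openin_topspace[of TG] by (simp_all add: G.topspace_eq_carrier)
  then obtain F W where F: "finite F" "F \<subseteq> carrier G"
    and W: "openin TG W" "\<one>\<^bsub>G\<^esub> \<in> W"
    and bound: "\<And>g. g \<in> W \<Longrightarrow> \<exists>f\<in>F. \<exists>v\<in>V. \<exists>w\<in>V.
      \<pi> g = inv\<^bsub>H\<^esub> (\<pi> f) \<otimes>\<^bsub>H\<^esub> (v \<otimes>\<^bsub>H\<^esub> inv\<^bsub>H\<^esub> w) \<otimes>\<^bsub>H\<^esub> \<pi> f"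
    by (rule conjugates[OF _ _ V]) (rule that)
  let ?q = "\<lambda>f z. inv\<^bsub>H\<^esub> (\<pi> f) \<otimes>\<^bsub>H\<^esub> (fst z \<otimes>\<^bsub>H\<^esub> inv\<^bsub>H\<^esub> (snd z)) \<otimes>\<^bsub>H\<^esub> \<pi> f"
  define C where "C = (\<Union>f\<in>F. ?q f ` (K \<times> K))"
  have "compactin TH (?q f ` (K \<times> K))" if "f \<in> F" for f
  proof (rule image_compactin)
    show "compactin (prod_topology TH TH) (K \<times> K)" using K by (simp add: compactin_Times)
    show "continuous_map (prod_topology TH TH) TH (?q f)"
      using that F(2)
      by (intro H.continuous_map_mult H.continuous_map_inverse continuous_map_fst continuous_map_snd)
        (auto simp: H.topspace_eq_carrier)
  qed
  then have C: "compactin TH C"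
    unfolding C_def using F(1) by (intro compactin_Union) auto
  have \<pi>_W: "\<pi> ` W \<subseteq> C"
  proof
    fix y assume "y \<in> \<pi> ` W"
    then obtain f v w where "f \<in> F" "v \<in> V" "w \<in> V" "y = ?q f (v, w)"
      using bound by fastforce
    then show "y \<in> C" unfolding C_def using K(2) by blast
  qed
  show ?thesis
  proof (rule continuous_hom_from_one[OF G.topological_group_axioms TH_group assms(4)])
    fix U assume "openin TH U" "\<one>\<^bsub>H\<^esub> \<in> U"
    then obtain V' where V': "openin TH V'" "\<one>\<^bsub>H\<^esub> \<in> V'"
      and small: "\<And>c v w. c \<in> C \<Longrightarrow> v \<in> V' \<Longrightarrow> w \<in> V' \<Longrightarrow>
        inv\<^bsub>H\<^esub> c \<otimes>\<^bsub>H\<^esub> (v \<otimes>\<^bsub>H\<^esub> inv\<^bsub>H\<^esub> w) \<otimes>\<^bsub>H\<^esub> c \<in> U"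
      by (rule H.uniform_conjugation_neighbourhood[OF C]) (rule that)
    \<comment> \<open>Second application: the conjugating elements are now taken from \<open>W\<close>, so their images
      lie in \<open>C\<close>, and \<open>V'\<close> is small with respect to all of them.\<close>
    obtain F' W' where F': "F' \<subseteq> W"
      and W': "openin TG W'" "\<one>\<^bsub>G\<^esub> \<in> W'"
      and conj: "\<And>g. g \<in> W' \<Longrightarrow> \<exists>f\<in>F'. \<exists>v\<in>V'. \<exists>w\<in>V'.
        \<pi> g = inv\<^bsub>H\<^esub> (\<pi> f) \<otimes>\<^bsub>H\<^esub> (v \<otimes>\<^bsub>H\<^esub> inv\<^bsub>H\<^esub> w) \<otimes>\<^bsub>H\<^esub> \<pi> f"
      by (rule conjugates[OF W V']) (rule that)
    have "\<pi> ` W' \<subseteq> U"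
    proof
      fix y assume "y \<in> \<pi> ` W'"
      then obtain f v w where "f \<in> F'" "v \<in> V'" "w \<in> V'"
        "y = inv\<^bsub>H\<^esub> (\<pi> f) \<otimes>\<^bsub>H\<^esub> (v \<otimes>\<^bsub>H\<^esub> inv\<^bsub>H\<^esub> w) \<otimes>\<^bsub>H\<^esub> \<pi> f"
        using conj by blast
      then show "y \<in> U" using small[of "\<pi> f"] F' \<pi>_W by blast
    qed
    then show "\<exists>W. openin TG W \<and> \<one>\<^bsub>G\<^esub> \<in> W \<and> \<pi> ` W \<subseteq> U" using W' by blast
  qed
qed

end
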